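(* Let $M\subset\mathbb{S}^n_+$ be nonempty, convex and compact, and let $\Omega_M:\mathbb{R}^{n\times m}\to\mathbb{R}\cup\{+\infty\}$, $\Omega_M(X)=\frac12\sigma_M(XX^T)$. Then, for every $X\in\mathbb{R}^{n\times m}$, $$\partial\Omega_M(X)=\Big\{VX : V\in\operatorname*{argmax}_{W\in M}\ \langle XX^T,W\rangle\Big\}.$$
   Context: $\mathbb{S}^n$ is the space of real symmetric $n\times n$ matrices with inner product $\langle X,Y\rangle=\mathrm{tr}(XY)$, and $\mathbb{S}^n_+$ the positive semidefinite ones. $\sigma_M(U)=\sup_{V\in M}\mathrm{tr}(VU)$ is the support function of $M$. $\mathbb{R}^{n\times m}$ carries the inner product $\langle X,Y\rangle=\mathrm{tr}(X^TY)$, and $\partial f(\bar X)=\{Y : f(\bar X)+\langle Y,X-\bar X\rangle\le f(X)\ \forall X\}$ is the subdifferential. *)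

theory Defs
  imports "HOL-Analysis.Analysis" "HOL-Library.Extended_Real"
begin

text \<open>
  An \<open>n \<times> m\<close> real matrix has type \<^typ>\<open>real^'m^'n\<close> (rows indexed by \<open>'n\<close>, columns by \<open>'m\<close>).
  Functions with values in \<open>\<real> \<union> {+\<infinity>}\<close> are rendered with codomain \<^typ>\<open>ereal\<close>.
\<close>

definition sym_matrices :: "(real^'n^'n) set" where
  "sym_matrices = {A. transpose A = A}"

definition psd_matrices :: "(real^'n^'n) set" where
  "psd_matrices = {A \<in> sym_matrices. \<forall>x. 0 \<le> x \<bullet> (A *v x)}"

text \<open>
  The inner product of the space of symmetric matrices, and the trace inner product of
  rectangular matrices. Both agree with the library inner product on their domains, so that
  \<^const>\<open>compact\<close> refers to the intended topology.
\<close>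

definition sym_inner :: "real^'n^'n \<Rightarrow> real^'n^'n \<Rightarrow> real" where
  "sym_inner A B = trace (A ** B)"

definition mat_inner :: "real^'m^'n \<Rightarrow> real^'m^'n \<Rightarrow> real" where
  "mat_inner A B = trace (transpose A ** B)"

lemma mat_inner_eq_inner: "mat_inner A B = A \<bullet> B"
proof -
  have "mat_inner A B = (\<Sum>j\<in>UNIV. \<Sum>i\<in>UNIV. A $ i $ j * B $ i $ j)"
    by (simp add: mat_inner_def trace_def matrix_matrix_mult_def transpose_def)
  also have "\<dots> = (\<Sum>i\<in>UNIV. \<Sum>j\<in>UNIV. A $ i $ j * B $ i $ j)"
    by (rule sum.swap)
  finally show ?thesis
    by (simp add: inner_vec_def)
qed

lemma sym_inner_eq_inner: "A \<in> sym_matrices \<Longrightarrow> sym_inner A B = A \<bullet> B"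
  using mat_inner_eq_inner[of A B] by (simp add: sym_inner_def mat_inner_def sym_matrices_def)

definition support_fun :: "(real^'n^'n) set \<Rightarrow> real^'n^'n \<Rightarrow> ereal" where
  "support_fun M U = (SUP V\<in>M. ereal (trace (V ** U)))"

definition Omega :: "(real^'n^'n) set \<Rightarrow> real^'m^'n \<Rightarrow> ereal" where
  "Omega M X = ereal (1/2) * support_fun M (X ** transpose X)"

definition subdifferential :: "(real^'m^'n \<Rightarrow> ereal) \<Rightarrow> real^'m^'n \<Rightarrow> (real^'m^'n) set" where
  "subdifferential f X0 = {Y. \<forall>X. f X0 + ereal (mat_inner Y (X - X0)) \<le> f X}"

end

theory Submission
  imports Defs
begin

text \<open>
  For symmetric \<open>V\<close> the quadratic form \<open>Z \<mapsto> \<langle>V, Z Z\<^sup>T\<rangle> / 2 = \<langle>Z, V Z\<rangle> / 2\<close> has gradient \<open>V X\<close> at \<open>X\<close>,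
  and it is convex when \<open>V\<close> is positive semidefinite; hence \<open>V X\<close> is a subgradient for every
  maximiser \<open>V\<close>. Conversely, the set \<open>K\<close> of all such \<open>V X\<close> is convex and compact. If a subgradient
  \<open>Y\<close> were outside \<open>K\<close>, some direction \<open>D\<close> would separate it strictly from \<open>K\<close>. Maximisers \<open>V\<^sub>t\<close> at
  \<open>X + t D\<close> satisfy \<open>\<langle>Y, D\<rangle> \<le> \<langle>V\<^sub>t X, D\<rangle> + t \<langle>D, V\<^sub>t D\<rangle> / 2\<close>, and any cluster point of \<open>V\<^sub>t\<close> as
  \<open>t \<down> 0\<close> is a maximiser \<open>V\<close> at \<open>X\<close> with \<open>\<langle>Y, D\<rangle> \<le> \<langle>V X, D\<rangle>\<close>, a contradiction.
\<close>

lemma sym_inner_gram: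
  fixes Z :: "real^'m^'n"
  shows "sym_inner (Z ** transpose Z) V = (Z ** transpose Z) \<bullet> V"
  by (rule sym_inner_eq_inner) (simp add: sym_matrices_def matrix_transpose_mul)

lemma trace_mul_gram:
  fixes Z :: "real^'m^'n"
  shows "trace (V ** (Z ** transpose Z)) = (Z ** transpose Z) \<bullet> V"
  by (metis sym_inner_gram sym_inner_def trace_mul_sym)

text \<open>By cyclicity of the trace, the functional maximised over \<open>M\<close>, linear in
  \<open>V\<close>, becomes a quadratic form in \<open>Z\<close>.\<close>

lemma gram_inner:
  fixes Z :: "real^'m^'n"
  shows "(Z ** transpose Z) \<bullet> V = Z \<bullet> (V ** Z)"
proof -
  have "(Z ** transpose Z) \<bullet> V = trace ((V ** Z) ** transpose Z)"
    by (simp add: trace_mul_gram[symmetric] matrix_mul_assoc)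
  also have "\<dots> = mat_inner Z (V ** Z)"
    by (simp add: mat_inner_def trace_mul_sym[of "V ** Z"])
  finally show ?thesis
    by (simp add: mat_inner_eq_inner)
qed

lemma inner_symmetric_mul:
  fixes Z W :: "real^'m^'n"
  assumes "V \<in> sym_matrices"
  shows "Z \<bullet> (V ** W) = (V ** Z) \<bullet> W"
  using assms
  by (simp add: mat_inner_eq_inner[symmetric] mat_inner_def sym_matrices_def
      matrix_transpose_mul matrix_mul_assoc)

text \<open>The form splits into the sum of the quadratic forms of \<open>V\<close> at the columns
  of \<open>Z\<close>.\<close>

lemma psd_inner_mul_nonneg:
  fixes Z :: "real^'m^'n"
  assumes "V \<in> psd_matrices"
  shows "0 \<le> Z \<bullet> (V ** Z)"
proof -
  have "Z \<bullet> (V ** Z) = (\<Sum>i\<in>UNIV. \<Sum>j\<in>UNIV. Z $ i $ j * (V ** Z) $ i $ j)"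
    by (simp add: inner_vec_def)
  also have "\<dots> = (\<Sum>j\<in>UNIV. column j Z \<bullet> (V *v column j Z))"
    by (subst sum.swap)
      (simp add: inner_vec_def column_def matrix_vector_mult_def matrix_matrix_mult_def)
  finally show ?thesis
    using assms by (simp add: psd_matrices_def sum_nonneg)
qed

lemma linear_matrix_mul_right: "linear (\<lambda>V. V ** (X :: real^'m^'n) :: real^'m^'k)"
  by (rule linearI)
    (simp_all add: matrix_matrix_mult_def vec_eq_iff distrib_right sum.distrib sum_distrib_left
      mult.assoc)

lemma quadratic_expansion:
  fixes X H :: "real^'m^'n"
  assumes "V \<in> sym_matrices"
  shows "(X + H) \<bullet> (V ** (X + H)) = X \<bullet> (V ** X) + 2 * ((V ** X) \<bullet> H) + H \<bullet> (V ** H)"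
  using inner_symmetric_mul[OF assms, of X H]
  by (simp add: matrix_add_ldistrib inner_add_left inner_add_right inner_commute)

lemma ex_is_arg_max_gram:
  fixes Z :: "real^'m^'n" and M :: "(real^'n^'n) set"
  assumes "M \<noteq> {}" and "compact M"
  shows "\<exists>V. is_arg_max (\<lambda>W. sym_inner (Z ** transpose Z) W) (\<lambda>W. W \<in> M) V"
proof -
  have "continuous_on M (\<lambda>W. (Z ** transpose Z) \<bullet> W)"
    by (intro continuous_intros)
  then show ?thesis
    using continuous_attains_sup[OF assms(2,1)]
    by (fastforce simp: is_arg_max_linorder sym_inner_gram)
qed

text \<open>The supremum is attained at \<open>V\<close>, so it is finite; this moves later
  inequalities from \<open>ereal\<close> to reals.\<close>

lemma Omega_eq_arg_max:
  fixes Z :: "real^'m^'n"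
  assumes "is_arg_max (\<lambda>W. sym_inner (Z ** transpose Z) W) (\<lambda>W. W \<in> M) V"
  shows "Omega M Z = ereal (Z \<bullet> (V ** Z) / 2)"
proof -
  have "support_fun M (Z ** transpose Z) = ereal (Z \<bullet> (V ** Z))"
    unfolding support_fun_def trace_mul_gram gram_inner using assms
    by (intro SUP_eqI) (auto simp: is_arg_max_linorder sym_inner_gram gram_inner)
  then show ?thesis
    by (simp add: Omega_def)
qed

lemma mul_arg_max_in_subdifferential:
  fixes X :: "real^'m^'n"
  assumes psd: "M \<subseteq> psd_matrices" and "compact M"
    and V: "is_arg_max (\<lambda>W. sym_inner (X ** transpose X) W) (\<lambda>W. W \<in> M) V"
  shows "V ** X \<in> subdifferential (Omega M) X"
  unfolding subdifferential_def
proof (intro CollectI allI)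
  fix Z :: "real^'m^'n"
  have VM: "V \<in> M"
    using V by (simp add: is_arg_max_def)
  then have Vpsd: "V \<in> psd_matrices"
    using psd by blast
  obtain U where U: "is_arg_max (\<lambda>W. sym_inner (Z ** transpose Z) W) (\<lambda>W. W \<in> M) U"
    using ex_is_arg_max_gram[of M Z] VM \<open>compact M\<close> by blast
  \<comment> \<open>Expansion around \<open>X\<close> leaves the remainder
    \<open>(Z - X) \<bullet> (V ** (Z - X))\<close>, which is nonnegative and is dropped.\<close>
  have "X \<bullet> (V ** X) + 2 * ((V ** X) \<bullet> (Z - X)) \<le> Z \<bullet> (V ** Z)"
    using quadratic_expansion[of V X "Z - X"] psd_inner_mul_nonneg[OF Vpsd, of "Z - X"] Vpsd
    by (simp add: psd_matrices_def)
  also have "\<dots> \<le> Z \<bullet> (U ** Z)"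
    using U VM by (simp add: is_arg_max_linorder sym_inner_gram gram_inner)
  finally show "Omega M X + ereal (mat_inner (V ** X) (Z - X)) \<le> Omega M Z"
    by (simp add: Omega_eq_arg_max[OF V] Omega_eq_arg_max[OF U] mat_inner_eq_inner)
qed

text \<open>The maximiser may depend on \<open>D\<close>; separation removes this dependence in
  \<open>corollary31\<close>.\<close>

lemma subgradient_le_directional:
  fixes X D Y :: "real^'m^'n"
  assumes sym: "M \<subseteq> sym_matrices" and M: "M \<noteq> {}" "compact M"
    and Y: "Y \<in> subdifferential (Omega M) X"
  shows "\<exists>V. is_arg_max (\<lambda>W. sym_inner (X ** transpose X) W) (\<lambda>W. W \<in> M) V
    \<and> Y \<bullet> D \<le> (V ** X) \<bullet> D"
proof -
  define t :: "nat \<Rightarrow> real" where "t k = inverse (real (Suc k))" for k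
  have tpos: "0 < t k" for k
    by (simp add: t_def)
  have t0: "t \<longlonglongrightarrow> 0"
    unfolding t_def by (rule LIMSEQ_inverse_real_of_nat)
  define Z where "Z k = X + t k *\<^sub>R D" for k
  obtain U where U: "is_arg_max (\<lambda>W. sym_inner (X ** transpose X) W) (\<lambda>W. W \<in> M) U"
    using ex_is_arg_max_gram[OF M] by blast
  have "\<forall>k. \<exists>V. is_arg_max (\<lambda>W. sym_inner (Z k ** transpose (Z k)) W) (\<lambda>W. W \<in> M) V"
    using ex_is_arg_max_gram[OF M] by blast
  then obtain V where
    V: "\<And>k. is_arg_max (\<lambda>W. sym_inner (Z k ** transpose (Z k)) W) (\<lambda>W. W \<in> M) (V k)"
    by metis
  have VM: "V k \<in> M" for k
    using V[of k] by (simp add: is_arg_max_def)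
  \<comment> \<open>This inequality serves twice: divided by \<open>t k\<close> it bounds
    \<open>Y \<bullet> D\<close>, and its limit shows that the cluster point is a maximiser at
    \<open>X\<close>.\<close>
  have key: "X \<bullet> (U ** X) / 2 + t k * (Y \<bullet> D)
      \<le> X \<bullet> (V k ** X) / 2 + t k * ((V k ** X) \<bullet> D) + (t k)\<^sup>2 / 2 * (D \<bullet> (V k ** D))" for k
  proof -
    have "Omega M X + ereal (mat_inner Y (Z k - X)) \<le> Omega M (Z k)"
      using Y by (simp add: subdifferential_def)
    then have "X \<bullet> (U ** X) / 2 + t k * (Y \<bullet> D) \<le> Z k \<bullet> (V k ** Z k) / 2"
      unfolding Omega_eq_arg_max[OF U] Omega_eq_arg_max[OF V] mat_inner_eq_inner
      by (simp add: Z_def)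
    moreover have "V k ** (t k *\<^sub>R D) = t k *\<^sub>R (V k ** D)"
      by (simp add: matrix_scalar_ac scalar_matrix_assoc)
    ultimately show ?thesis
      using quadratic_expansion[of "V k" X "t k *\<^sub>R D"] VM[of k] sym
      by (auto simp: Z_def power2_eq_square field_simps)
  qed
  \<comment> \<open>Maximality of \<open>U\<close> lets the zeroth-order terms of \<open>key\<close>
    be discarded before dividing by \<open>t k\<close>.\<close>
  have Vle: "X \<bullet> (V k ** X) \<le> X \<bullet> (U ** X)" for k
    using U VM by (simp add: is_arg_max_linorder sym_inner_gram gram_inner)
  have slope: "Y \<bullet> D \<le> (V k ** X) \<bullet> D + t k / 2 * (D \<bullet> (V k ** D))" for k
  proof -
    have "t k * (Y \<bullet> D) \<le> t k * ((V k ** X) \<bullet> D + t k / 2 * (D \<bullet> (V k ** D)))"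
      using key[of k] Vle[of k] by (simp add: power2_eq_square algebra_simps)
    then show ?thesis
      using tpos[of k] by simp
  qed
  obtain L r where L: "L \<in> M" and r: "strict_mono r" and lim: "(V \<circ> r) \<longlonglongrightarrow> L"
    using M(2) VM unfolding compact_def by metis
  have tr: "(\<lambda>k. t (r k)) \<longlonglongrightarrow> 0"
    using LIMSEQ_subseq_LIMSEQ[OF t0 r] by (simp add: o_def)
  have mul: "(\<lambda>k. V (r k) ** C) \<longlonglongrightarrow> L ** C" for C :: "real^'m^'n"
    using bounded_linear.tendsto[OF linear_conv_bounded_linear[THEN iffD1, OF linear_matrix_mul_right] lim]
    by (simp add: o_def)
  have "(\<lambda>k. (V (r k) ** X) \<bullet> D + t (r k) / 2 * (D \<bullet> (V (r k) ** D)))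
      \<longlonglongrightarrow> (L ** X) \<bullet> D + 0 / 2 * (D \<bullet> (L ** D))"
    by (intro tendsto_intros mul tr) simp
  then have "Y \<bullet> D \<le> (L ** X) \<bullet> D + 0 / 2 * (D \<bullet> (L ** D))"
    by (rule LIMSEQ_le_const) (use slope in blast)
  \<comment> \<open>In the limit of \<open>key\<close> only the zeroth-order terms survive, so
    \<open>L\<close> inherits maximality from \<open>U\<close>. The zero terms stay unsimplified to
    match the termwise limits.\<close>
  moreover have "X \<bullet> (U ** X) / 2 + 0 * (Y \<bullet> D)
      \<le> X \<bullet> (L ** X) / 2 + 0 * ((L ** X) \<bullet> D) + 0\<^sup>2 / 2 * (D \<bullet> (L ** D))"
  proof (rule LIMSEQ_le)
    show "(\<lambda>k. X \<bullet> (U ** X) / 2 + t (r k) * (Y \<bullet> D))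
        \<longlonglongrightarrow> X \<bullet> (U ** X) / 2 + 0 * (Y \<bullet> D)"
      by (intro tendsto_intros tr)
    show "(\<lambda>k. X \<bullet> (V (r k) ** X) / 2 + t (r k) * ((V (r k) ** X) \<bullet> D)
          + (t (r k))\<^sup>2 / 2 * (D \<bullet> (V (r k) ** D)))
        \<longlonglongrightarrow> X \<bullet> (L ** X) / 2 + 0 * ((L ** X) \<bullet> D) + 0\<^sup>2 / 2 * (D \<bullet> (L ** D))"
      by (intro tendsto_intros mul tr) simp_all
  qed (use key in blast)
  ultimately show ?thesis
    using U L by (fastforce simp: is_arg_max_linorder sym_inner_gram gram_inner)
qed

text \<open>If nonempty, \<open>F\<close> is the face that a hyperplane through one maximiser cuts
  from \<open>M\<close>.\<close>

lemma convex_compact_arg_max_gram: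
  fixes X :: "real^'m^'n"
  assumes "convex M" and "compact M"
  defines "F \<equiv> {V. is_arg_max (\<lambda>W. sym_inner (X ** transpose X) W) (\<lambda>W. W \<in> M) V}"
  shows "convex F \<and> compact F"
proof (cases "F = {}")
  case False
  then obtain U where U: "is_arg_max (\<lambda>W. sym_inner (X ** transpose X) W) (\<lambda>W. W \<in> M) U"
    unfolding F_def by blast
  then have "F = M \<inter> {V. (X ** transpose X) \<bullet> V = (X ** transpose X) \<bullet> U}"
    unfolding F_def by (auto simp: is_arg_max_linorder sym_inner_gram intro: antisym)
  then show ?thesis
    using assms by (auto intro: convex_Int convex_hyperplane compact_Int_closed closed_hyperplane)
qed simp

theorem corollary31:
  fixes M :: "(real^'n^'n) set" and X :: "real^'m^'n"
  assumes "M \<subseteq> psd_matrices" and "M \<noteq> {}" and "convex M" and "compact M"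
  shows "subdifferential (Omega M) X =
    {V ** X | V. is_arg_max (\<lambda>W. sym_inner (X ** transpose X) W) (\<lambda>W. W \<in> M) V}"
proof -
  define F where "F = {V. is_arg_max (\<lambda>W. sym_inner (X ** transpose X) W) (\<lambda>W. W \<in> M) V}"
  define K where "K = (\<lambda>V. V ** X) ` F"
  have sym: "M \<subseteq> sym_matrices"
    using assms(1) by (auto simp: psd_matrices_def)
  have F: "convex F" "compact F"
    using convex_compact_arg_max_gram[OF assms(3,4), of X] by (simp_all add: F_def)
  have "convex K"
    unfolding K_def by (rule convex_linear_image[OF linear_matrix_mul_right F(1)])
  moreover have "closed K"
    unfolding K_def
    by (intro compact_imp_closed compact_continuous_image F(2) linear_continuous_on
        linear_conv_bounded_linear[THEN iffD1] linear_matrix_mul_right)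
  ultimately have "Y \<in> K" if Y: "Y \<in> subdifferential (Omega M) X" for Y
  proof (rule_tac ccontr)
    assume "Y \<notin> K"
    then obtain a b where ab: "a \<bullet> Y < b" "\<forall>W\<in>K. b < a \<bullet> W"
      using separating_hyperplane_closed_point[OF \<open>convex K\<close> \<open>closed K\<close>] by blast
    \<comment> \<open>Separation puts \<open>Y\<close> below \<open>K\<close> along
      \<open>a\<close>, whereas the directional lemma bounds \<open>Y\<close> from above; hence the
      direction \<open>- a\<close>.\<close>
    obtain V where "V \<in> F" and "Y \<bullet> (- a) \<le> (V ** X) \<bullet> (- a)"
      using subgradient_le_directional[OF sym assms(2,4) Y, of "- a"] by (auto simp: F_def)
    then show False
      using ab by (fastforce simp: K_def inner_commute)
  qed
  moreover have "K \<subseteq> subdifferential (Omega M) X"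
    using mul_arg_max_in_subdifferential[OF assms(1,4)] by (auto simp: K_def F_def)
  moreover have "K = {V ** X | V. is_arg_max (\<lambda>W. sym_inner (X ** transpose X) W) (\<lambda>W. W \<in> M) V}"
    by (auto simp: K_def F_def)
  ultimately show ?thesis
    by blast
qed

end
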